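(* Let $T$ be a fault tree with set of basic events $\mathrm{BE}_T$, and let $\vec{\mathsf{p}}=(\mathsf{p}_v)_{v\in \mathrm{BE}_T} \in \mathbf{F}([0,1])^{\mathrm{BE}_T}$ be a fuzzy probabilistic status vector. Assume that for every $v\in \mathrm{BE}_T$, $\mathsf{p}_v$ (extended by $0$ outside $[0,1]$) is a regular fuzzy number, and write its $\alpha$-cuts as $$\mathsf{p}_v^{(\alpha)} = [\mathsf{p}_v^{(\alpha, l)}, \mathsf{p}_v^{(\alpha, r)}],$$ and set $\vec{\mathsf{p}}^{(\alpha, l)}:= (\mathsf{p}_v^{(\alpha, l)})_{v\in \mathrm{BE}_T}$ and $\vec{\mathsf{p}}^{(\alpha, r)}:= (\mathsf{p}_v^{(\alpha, r)})_{v\in \mathrm{BE}_T}$, for all $\alpha\in (0,1]$. Then, for all $\alpha\in(0,1]$, the $\alpha$-cut of the fuzzy unreliability $\widetilde{U}_T(\vec{\mathsf{p}})$ is $$\widetilde{U}_T(\vec{\mathsf{p}})^{(\alpha)} = \left[U_T\left(\vec{\mathsf{p}}^{(\alpha, l)}\right),\; U_T\left(\vec{\mathsf{p}}^{(\alpha, r)}\right)\right].$$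
   Context: **Fault trees.** A fault tree is a tuple $T=(V,E,t)$ where $(V,E)$ is a (finite) rooted directed acyclic graph with root $R_T$, and $t\colon V\to\{\mathtt{BE},\mathtt{OR},\mathtt{AND}\}$ is a map such that $t(v)=\mathtt{BE}$ if and only if $v$ is a leaf. Let $\mathrm{BE}_T=\{v\in V: t(v)=\mathtt{BE}\}$, and let $ch(v)$ be the set of children of $v$. The underlying graph need not be a tree. Let $\mathbb{B}=\{0,1\}$. The structure function $S_T\colon V\times\mathbb{B}^{\mathrm{BE}_T}\to\mathbb{B}$ is defined recursively by $S_T(v,\vec b)=\bigvee_{w\in ch(v)}S_T(w,\vec b)$ if $t(v)=\mathtt{OR}$, $S_T(v,\vec b)=\bigwedge_{w\in ch(v)}S_T(w,\vec b)$ if $t(v)=\mathtt{AND}$, and $S_T(v,\vec b)=b_v$ if $t(v)=\mathtt{BE}$. Write $S_T(\vec b)=S_T(R_T,\vec b)$. **Unreliability.** For $\vec p\in[0,1]^{\mathrm{BE}_T}$, $U_T(\vec p)=\mathbb{P}[S_T(\vec B)=1]$, where $\vec B=(B_v)_{v\in\mathrm{BE}_T}$ has independent components with $B_v$ Bernoulli-distributed with $\mathbb{P}[B_v=1]=p_v$. Equivalently, $U_T(\vec p)=\sum_{\vec b:\,S_T(\vec b)=1}\prod_{v\in\mathrm{BE}_T}p_v^{b_v}(1-p_v)^{1-b_v}$. **Fuzzy elements.** A fuzzy element of a set $X$ is a function $\mathsf{x}\colon X\to[0,1]$, with value at $x$ written $\mathsf{x}[x]$; $\mathbf{F}(X)$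 is the set of all of them. For $\alpha\in[0,1]$, the $\alpha$-cut is $\mathsf{x}^{(\alpha)}=\{x\in X:\mathsf{x}[x]\ge\alpha\}$. A regular fuzzy number is $\mathsf{x}\in\mathbf{F}(\mathbb{R})$ such that (1) for every $\alpha\in(0,1]$, $\mathsf{x}^{(\alpha)}$ is a (nonempty) compact interval $[l,r]$ with $l\le r$, and (2) $\{x\in\mathbb{R}:\mathsf{x}[x]\ne0\}$ is bounded. **Fuzzy unreliability.** $\widetilde U_T\colon\mathbf{F}([0,1])^{\mathrm{BE}_T}\to\mathbf{F}([0,1])$ is the Zadeh extension of $U_T$, i.e. for $y\in[0,1]$, $$\widetilde U_T(\vec{\mathsf p})[y]=\sup\left\{\min_{v\in\mathrm{BE}_T}\mathsf p_v[p_v]\;:\;\vec p\in[0,1]^{\mathrm{BE}_T},\ U_T(\vec p)=y\right\},$$ with the supremum of the empty set equal to $0$. *)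

theory Defs
  imports "HOL-Probability.Probability" "HOL-Probability.Product_PMF"
begin

section \<open>Fault trees\<close>

datatype node_type = BE | OR | AND

record 'v fault_tree =
  verts :: "'v set"
  edges :: "('v \<times> 'v) set"
  ntype :: "'v \<Rightarrow> node_type"

definition children :: "'v fault_tree \<Rightarrow> 'v \<Rightarrow> 'v set" where
  "children T v = {w. (v, w) \<in> edges T}"

definition basic_events :: "'v fault_tree \<Rightarrow> 'v set" where
  "basic_events T = {v \<in> verts T. ntype T v = BE}"

definition is_root :: "'v fault_tree \<Rightarrow> 'v \<Rightarrow> bool" where
  "is_root T r \<longleftrightarrow> r \<in> verts T \<and> (\<forall>v\<in>verts T. (r, v) \<in> (edges T)\<^sup>*)"

definition root_node :: "'v fault_tree \<Rightarrow> 'v" where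
  "root_node T = (THE r. is_root T r)"

definition is_fault_tree :: "'v fault_tree \<Rightarrow> bool" where
  "is_fault_tree T \<longleftrightarrow>
     finite (verts T) \<and> edges T \<subseteq> verts T \<times> verts T \<and> acyclic (edges T) \<and>
     (\<exists>r. is_root T r) \<and>
     (\<forall>v\<in>verts T. ntype T v = BE \<longleftrightarrow> children T v = {})"

lemma is_root_unique:
  assumes "is_fault_tree T" "is_root T r" "is_root T r'"
  shows "r = r'"
proof (rule ccontr)
  assume "r \<noteq> r'"
  with assms have "(r, r') \<in> (edges T)\<^sup>+" "(r', r) \<in> (edges T)\<^sup>+"
    by (auto simp: is_root_def rtrancl_eq_or_trancl)
  with assms(1) show False
    by (meson acyclic_def is_fault_tree_def trancl_trans)
qed

lemma is_root_root_node:
  assumes "is_fault_tree T"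
  shows "is_root T (root_node T)"
proof -
  obtain r where r: "is_root T r"
    using assms unfolding is_fault_tree_def by blast
  show ?thesis
    unfolding root_node_def by (rule theI[of "is_root T", OF r]) (rule is_root_unique[OF assms _ r])
qed

lemma finite_basic_events: "is_fault_tree T \<Longrightarrow> finite (basic_events T)"
  by (simp add: is_fault_tree_def basic_events_def)

lemma wf_children:
  assumes "is_fault_tree T"
  shows "wf ((edges T)\<inverse>)"
proof -
  have "finite (edges T)"
    using assms unfolding is_fault_tree_def by (meson finite_SigmaI finite_subset)
  with assms show ?thesis
    by (simp add: is_fault_tree_def finite_acyclic_wf_converse)
qed

lemma basic_events_nonempty:
  assumes "is_fault_tree T"
  shows "basic_events T \<noteq> {}"
proof -
  have "root_node T \<in> verts T"
    using is_root_root_node[OF assms] by (simp add: is_root_def)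
  then obtain v where "v \<in> verts T" "\<And>w. (w, v) \<in> (edges T)\<inverse> \<Longrightarrow> w \<notin> verts T"
    using wfE_min[OF wf_children[OF assms]] by metis
  then have "v \<in> verts T" "children T v = {}"
    using assms by (auto simp: is_fault_tree_def children_def)
  with assms show ?thesis
    by (auto simp: is_fault_tree_def basic_events_def)
qed

text \<open>The guard only makes the recursion total: it runs along the edges, which are well-founded
  downwards in a fault tree. The Booleans 0 and 1 are \<^const>\<open>False\<close> and \<^const>\<open>True\<close>.\<close>

function structure_fun :: "'v fault_tree \<Rightarrow> 'v \<Rightarrow> ('v \<Rightarrow> bool) \<Rightarrow> bool" where
  "structure_fun T v b =
     (if is_fault_tree T then
        (case ntype T v of
           OR \<Rightarrow> (\<exists>w\<in>children T v. structure_fun T w b)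
         | AND \<Rightarrow> (\<forall>w\<in>children T v. structure_fun T w b)
         | BE \<Rightarrow> b v)
      else False)"
  by pat_completeness auto
termination
proof (relation "{((T', w, b'), (T, v, b)). T' = T \<and> is_fault_tree T \<and> (v, w) \<in> edges T}")
  show "wf {((T', w, b'), (T :: 'v fault_tree, v, b :: 'v \<Rightarrow> bool)).
             T' = T \<and> is_fault_tree T \<and> (v, w) \<in> edges T}" (is "wf ?R")
  proof (rule wfUNIVI)
    fix P :: "'v fault_tree \<times> 'v \<times> ('v \<Rightarrow> bool) \<Rightarrow> bool" and x
    assume step: "\<forall>x. (\<forall>y. (y, x) \<in> ?R \<longrightarrow> P y) \<longrightarrow> P x"
    have "\<forall>b. P (T, v, b)" for T v
    proof (cases "is_fault_tree T")
      case True
      show ?thesis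
      proof (induction v rule: wf_induct_rule[OF wf_children[OF True]])
        case (1 v)
        show ?case
          by (rule allI, rule step[rule_format]) (use 1 in auto)
      qed
    next
      case False
      show ?thesis
        by (rule allI, rule step[rule_format]) (use False in auto)
    qed
    then show "P x"
      by (cases x) auto
  qed
qed (auto simp: children_def)

declare structure_fun.simps [simp del]

section \<open>Unreliability\<close>

text \<open>Status vectors indexed by the basic events are total functions, whose values outside
  \<^term>\<open>basic_events T\<close> are irrelevant.\<close>

definition unreliability :: "'v fault_tree \<Rightarrow> ('v \<Rightarrow> real) \<Rightarrow> real" where
  "unreliability T p =
     measure_pmf.prob (Pi_pmf (basic_events T) False (\<lambda>v. bernoulli_pmf (p v)))
       {b. structure_fun T (root_node T) b}"

section \<open>Fuzzy elements\<close>

text \<open>A fuzzy element of \<^term>\<open>X\<close> is a total function of which only the values on \<^term>\<open>X\<close>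
  matter; hence the carrier \<^term>\<open>X\<close> is an argument of the cut as well.\<close>

definition fuzzy_elements :: "'a set \<Rightarrow> ('a \<Rightarrow> real) set" where
  "fuzzy_elements X = (X \<rightarrow> {0..1})"

definition alpha_cut :: "'a set \<Rightarrow> ('a \<Rightarrow> real) \<Rightarrow> real \<Rightarrow> 'a set" where
  "alpha_cut X x \<alpha> = {a \<in> X. x a \<ge> \<alpha>}"

definition extend_zero :: "'a set \<Rightarrow> ('a \<Rightarrow> real) \<Rightarrow> 'a \<Rightarrow> real" where
  "extend_zero X x = (\<lambda>a. if a \<in> X then x a else 0)"

definition regular_fuzzy_number :: "(real \<Rightarrow> real) \<Rightarrow> bool" where
  "regular_fuzzy_number x \<longleftrightarrow>
     x \<in> fuzzy_elements UNIV \<and>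
     (\<forall>\<alpha>\<in>{0<..1}. \<exists>l r. l \<le> r \<and> alpha_cut UNIV x \<alpha> = {l..r}) \<and>
     bounded {a. x a \<noteq> 0}"

definition zadeh_extension ::
  "'i set \<Rightarrow> 'a set \<Rightarrow> (('i \<Rightarrow> 'a) \<Rightarrow> 'b) \<Rightarrow> ('i \<Rightarrow> 'a \<Rightarrow> real) \<Rightarrow> 'b \<Rightarrow> real" where
  "zadeh_extension I X f x y =
     (let D = {Min ((\<lambda>i. x i (a i)) ` I) | a. a \<in> I \<rightarrow>\<^sub>E X \<and> f a = y}
      in if D = {} then 0 else Sup D)"

definition fuzzy_unreliability :: "'v fault_tree \<Rightarrow> ('v \<Rightarrow> real \<Rightarrow> real) \<Rightarrow> real \<Rightarrow> real" where
  "fuzzy_unreliability T = zadeh_extension (basic_events T) {0..1} (unreliability T)"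

end

theory Submission
  imports Defs "HOL-Real_Asymp.Real_Asymp"
begin

text \<open>The unreliability is continuous, since it is a polynomial in the probabilities, and monotone,
  since the structure function is. A point of a segment between the vectors of left and of right
  cut ends therefore realises any value between their unreliabilities, by the intermediate value
  theorem. Conversely, a supremum of at least \<open>\<alpha>\<close> yields for each \<open>\<beta> < \<alpha>\<close> a witness in the
  \<open>\<beta>\<close>-cuts, and the ends of the \<open>\<beta>\<close>-cuts converge to those of the \<open>\<alpha>\<close>-cut as \<open>\<beta>\<close> increases
  to \<open>\<alpha>\<close>.\<close>

section \<open>Monotonicity and continuity of the unreliability\<close>

text \<open>Gates are disjunctions and conjunctions without negation, so monotonicity passes from
  the children to their parent; the induction goes up from the leaves.\<close>

lemma structure_fun_mono:
  assumes T: "is_fault_tree T" and b: "\<And>v. b v \<Longrightarrow> b' v"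
    and S: "structure_fun T v b"
  shows "structure_fun T v b'"
  using S
proof (induction v rule: wf_induct_rule[OF wf_children[OF T]])
  case (1 v)
  then show ?case
    using T b structure_fun.simps[of T v b] structure_fun.simps[of T v b']
    by (cases "ntype T v") (auto simp: children_def)
qed

text \<open>Thinning: a success of probability \<open>q\<close> is kept with independent probability
  \<open>p / q\<close>. This puts the smaller and the larger variable on one probability space, with
  the smaller implying the larger.\<close>

lemma bernoulli_pmf_coupling:
  assumes "0 \<le> p" "p \<le> q" "q \<le> 1"
  shows "bernoulli_pmf p =
    map_pmf (\<lambda>(x, y). x \<and> y) (pair_pmf (bernoulli_pmf q) (bernoulli_pmf (p / q)))"
proof -
  \<comment> \<open>This includes \<open>q = 0\<close>: then \<open>p = 0\<close>, and
    \<open>p / q = 0\<close> by the convention on division by zero.\<close>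
  have pq: "0 \<le> p / q" "p / q \<le> 1" "q * (p / q) = p"
    using assms by (auto simp: divide_simps)
  have "(\<lambda>(x, y). x \<and> y) -` {True} = {(True, True)}"
    by auto
  then have "pmf (map_pmf (\<lambda>(x, y). x \<and> y) (pair_pmf (bernoulli_pmf q) (bernoulli_pmf (p / q)))) True
      = pmf (bernoulli_pmf p) True"
    using assms pq by (simp add: pmf_map measure_pmf_single pmf_pair)
  moreover have "pmf M False = 1 - pmf M True" for M :: "bool pmf"
    using sum_pmf_eq_1[OF finite subset_UNIV, of M] by (simp add: UNIV_bool)
  ultimately show ?thesis
    by (intro pmf_eqI) (metis (full_types))
qed

text \<open>Both products are images of one distribution \<open>G\<close> of vectors of pairs: first
  components give \<open>q\<close>, conjunctions give \<open>p\<close>. The conjunctions lie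
  pointwise below the first components, so an upward closed \<open>S\<close> that contains the
  former contains the latter.\<close>

lemma prob_Pi_bernoulli_mono:
  assumes A: "finite A"
    and pq: "\<And>v. v \<in> A \<Longrightarrow> 0 \<le> p v \<and> p v \<le> q v \<and> q v \<le> 1"
    and S: "\<And>b b'. b \<in> S \<Longrightarrow> (\<And>v. b v \<Longrightarrow> b' v) \<Longrightarrow> b' \<in> S"
  shows "measure_pmf.prob (Pi_pmf A False (\<lambda>v. bernoulli_pmf (p v))) S
    \<le> measure_pmf.prob (Pi_pmf A False (\<lambda>v. bernoulli_pmf (q v))) S"
proof -
  define G where "G = Pi_pmf A (False, False)
    (\<lambda>v. pair_pmf (bernoulli_pmf (q v)) (bernoulli_pmf (p v / q v)))"
  have "Pi_pmf A False (\<lambda>v. bernoulli_pmf (p v)) = Pi_pmf A False (\<lambda>v. map_pmf (\<lambda>(x, y). x \<and> y)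
      (pair_pmf (bernoulli_pmf (q v)) (bernoulli_pmf (p v / q v))))"
    using pq by (intro Pi_pmf_cong refl bernoulli_pmf_coupling) auto
  also have "\<dots> = map_pmf (\<lambda>h. (\<lambda>(x, y). x \<and> y) \<circ> h) G"
    unfolding G_def using A by (intro Pi_pmf_map) auto
  finally have p: "Pi_pmf A False (\<lambda>v. bernoulli_pmf (p v)) = \<dots>" .
  have "Pi_pmf A False (\<lambda>v. bernoulli_pmf (q v)) = Pi_pmf A False (\<lambda>v. map_pmf fst
      (pair_pmf (bernoulli_pmf (q v)) (bernoulli_pmf (p v / q v))))"
    by (simp add: map_fst_pair_pmf)
  also have "\<dots> = map_pmf (\<lambda>h. fst \<circ> h) G"
    unfolding G_def using A by (intro Pi_pmf_map) auto
  finally have q: "Pi_pmf A False (\<lambda>v. bernoulli_pmf (q v)) = \<dots>" .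
  have "fst \<circ> h \<in> S" if "(\<lambda>(x, y). x \<and> y) \<circ> h \<in> S" for h :: "'a \<Rightarrow> bool \<times> bool"
    by (rule S[OF that]) (simp add: case_prod_beta)
  then show ?thesis
    unfolding p q measure_map_pmf
    by (intro measure_pmf.finite_measure_mono) auto
qed

lemma unreliability_mono:
  assumes T: "is_fault_tree T"
    and "\<And>v. v \<in> basic_events T \<Longrightarrow> 0 \<le> p v \<and> p v \<le> q v \<and> q v \<le> 1"
  shows "unreliability T p \<le> unreliability T q"
  unfolding unreliability_def using assms structure_fun_mono[OF T]
  by (intro prob_Pi_bernoulli_mono) (auto simp: finite_basic_events)

text \<open>The support consists of functions equal to \<open>d\<close> outside \<open>A\<close>, of
  which there are finitely many. The probability is thus a polynomial in the point masses of the
  factors, and limits can be taken term by term.\<close>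

lemma prob_Pi_pmf_finite_type:
  fixes P :: "'v \<Rightarrow> 'b :: finite pmf"
  assumes A: "finite A"
  shows "measure_pmf.prob (Pi_pmf A d P) S =
    (\<Sum>b\<in>S \<inter> PiE_dflt A d (\<lambda>_. UNIV). \<Prod>v\<in>A. pmf (P v) (b v))"
proof -
  let ?D = "PiE_dflt A d (\<lambda>_. UNIV :: 'b set)"
  have "set_pmf (Pi_pmf A d P) \<subseteq> ?D"
    using set_Pi_pmf_subset[OF A, of d P] by (auto simp: PiE_dflt_def)
  then have "measure_pmf.prob (Pi_pmf A d P) S = measure_pmf.prob (Pi_pmf A d P) (S \<inter> ?D)"
    by (intro measure_prob_cong_0) (auto simp: set_pmf_iff)
  also have "\<dots> = (\<Sum>b\<in>S \<inter> ?D. pmf (Pi_pmf A d P) b)"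
    using A by (intro measure_measure_pmf_finite finite_Int disjI2 finite_PiE_dflt) auto
  also have "\<dots> = (\<Sum>b\<in>S \<inter> ?D. \<Prod>v\<in>A. pmf (P v) (b v))"
    by (intro sum.cong refl pmf_Pi'[OF A]) (auto simp: PiE_dflt_def)
  finally show ?thesis .
qed

text \<open>No bounds are needed below since \<^const>\<open>bernoulli_pmf\<close> clamps its argument to the
  unit interval.\<close>

lemma tendsto_pmf_bernoulli:
  assumes "(f \<longlongrightarrow> l) F"
  shows "((\<lambda>x. pmf (bernoulli_pmf (f x)) b) \<longlongrightarrow> pmf (bernoulli_pmf l) b) F"
proof -
  have "pmf (bernoulli_pmf p) b = (if b then min 1 (max 0 p) else 1 - min 1 (max 0 p))" for p
    by (simp add: bernoulli_pmf.rep_eq)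
  with assms show ?thesis
    by (auto intro!: tendsto_intros)
qed

lemma tendsto_unreliability:
  assumes T: "is_fault_tree T"
    and "\<And>v. v \<in> basic_events T \<Longrightarrow> ((\<lambda>x. f x v) \<longlongrightarrow> l v) F"
  shows "((\<lambda>x. unreliability T (f x)) \<longlongrightarrow> unreliability T l) F"
  unfolding unreliability_def prob_Pi_pmf_finite_type[OF finite_basic_events[OF T]]
  by (intro tendsto_sum tendsto_prod tendsto_pmf_bernoulli assms)

lemma unreliability_intermediate_value:
  assumes T: "is_fault_tree T"
    and lr: "\<And>v. v \<in> basic_events T \<Longrightarrow> l v \<le> r v"
    and y: "unreliability T l \<le> y" "y \<le> unreliability T r"
  obtains a where "\<And>v. v \<in> basic_events T \<Longrightarrow> a v \<in> {l v..r v}" "unreliability T a = y"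
proof -
  \<comment> \<open>The segment from \<open>l\<close> at \<open>t = 0\<close> to \<open>r\<close> at
    \<open>t = 1\<close> reduces the claim to one real variable.\<close>
  define c where "c t v = l v + t * (r v - l v)" for t v
  have "isCont (\<lambda>t. unreliability T (c t)) t" for t
    unfolding isCont_def c_def by (intro tendsto_unreliability[OF T] tendsto_intros)
  moreover have "c 0 = l" "c 1 = r"
    by (auto simp: c_def fun_eq_iff)
  ultimately obtain t where t: "0 \<le> t" "t \<le> 1" "unreliability T (c t) = y"
    using IVT[of "\<lambda>t. unreliability T (c t)" 0 y 1] y by auto
  show thesis
  proof (rule that[of "c t"])
    fix v assume "v \<in> basic_events T"
    then have "0 \<le> r v - l v"
      using lr by simp
    then have "0 \<le> t * (r v - l v)" "t * (r v - l v) \<le> r v - l v"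
      using t mult_right_mono[of t 1 "r v - l v"] by auto
    then show "c t v \<in> {l v..r v}"
      by (auto simp: c_def)
  qed (use t in simp)
qed

text \<open>The Zadeh extension ranges over extensional vectors, whereas the intermediate value
  argument yields a total function; only values on the basic events enter the product
  distribution.\<close>

lemma unreliability_restrict:
  "unreliability T (restrict a (basic_events T)) = unreliability T a"
proof -
  have "Pi_pmf (basic_events T) False (\<lambda>v. bernoulli_pmf (restrict a (basic_events T) v))
      = Pi_pmf (basic_events T) False (\<lambda>v. bernoulli_pmf (a v))"
    by (intro Pi_pmf_cong) auto
  then show ?thesis
    by (simp add: unreliability_def)
qed

section \<open>Cuts\<close>

text \<open>The ends converge by monotonicity and boundedness. Their limits belong to every
  interval, hence to \<open>{L..R}\<close>, which forces them to be \<open>L\<close> and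
  \<open>R\<close>.\<close>

lemma nested_intervals_ends_tendsto:
  fixes l r :: "nat \<Rightarrow> real"
  assumes l: "incseq l" and r: "decseq r"
    and I: "(\<Inter>n. {l n..r n}) = {L..R}" and LR: "L \<le> R"
  shows "l \<longlonglongrightarrow> L" "r \<longlonglongrightarrow> R"
proof -
  have "L \<in> (\<Inter>n. {l n..r n})" "R \<in> (\<Inter>n. {l n..r n})"
    using I LR by auto
  then have bounds: "l n \<le> L" "R \<le> r n" for n
    by auto
  obtain L' where L': "l \<longlonglongrightarrow> L'" "\<And>n. l n \<le> L'"
    using incseq_convergent[OF l] bounds by metis
  obtain R' where R': "r \<longlonglongrightarrow> R'" "\<And>n. R' \<le> r n"
    using decseq_convergent[OF r] bounds by metis
  have "L' \<le> L" "R \<le> R'"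
    using LIMSEQ_le_const2[OF L'(1)] LIMSEQ_le_const[OF R'(1)] bounds by auto
  moreover have "l n \<le> R'" "L' \<le> r n" for n
    using bounds[of n] LR \<open>L' \<le> L\<close> \<open>R \<le> R'\<close> by linarith+
  ultimately have "L' \<in> (\<Inter>n. {l n..r n})" "R' \<in> (\<Inter>n. {l n..r n})"
    using L' R' by auto
  then have "L \<le> L'" "R' \<le> R"
    unfolding I by auto
  with \<open>L' \<le> L\<close> \<open>R \<le> R'\<close> L' R' show "l \<longlonglongrightarrow> L" "r \<longlonglongrightarrow> R"
    by auto
qed

text \<open>A membership degree that is at least every \<open>\<beta> n\<close> is at least their
  limit, so the cuts at the levels \<open>\<beta> n\<close> are nested with the cut at
  \<open>\<alpha>\<close> as intersection.\<close>

lemma alpha_cut_ends_tendsto: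
  fixes x :: "real \<Rightarrow> real" and \<beta> :: "nat \<Rightarrow> real"
  assumes \<beta>: "incseq \<beta>" "\<beta> \<longlonglongrightarrow> \<alpha>"
    and cut: "\<And>n. alpha_cut X x (\<beta> n) = {l n..r n}"
    and cut': "alpha_cut X x \<alpha> = {L..R}" and LR: "L \<le> R"
  shows "l \<longlonglongrightarrow> L" "r \<longlonglongrightarrow> R"
proof -
  have le: "\<beta> n \<le> \<alpha>" for n
    using incseq_le[OF \<beta>] .
  have "{L..R} \<subseteq> {l n..r n}" for n
    unfolding cut[symmetric] cut'[symmetric] using le[of n] by (auto simp: alpha_cut_def)
  \<comment> \<open>Inclusion of intervals gives inequalities of their ends only when the smaller
    interval is nonempty.\<close>
  then have ne: "l n \<le> r n" for n
    using LR by (metis atLeastatMost_subset_iff order_trans)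
  have "{l n..r n} \<subseteq> {l m..r m}" if "m \<le> n" for m n
    unfolding cut[symmetric] using incseqD[OF \<beta>(1) that] by (auto simp: alpha_cut_def)
  then have "incseq l" "decseq r"
    using ne by (auto simp: incseq_def decseq_def)
  moreover have "(\<Inter>n. {l n..r n}) = {L..R}"
    unfolding cut[symmetric] cut'[symmetric] using le LIMSEQ_le_const2[OF \<beta>(2)]
    by (auto simp: alpha_cut_def intro: order_trans)
  ultimately show "l \<longlonglongrightarrow> L" "r \<longlonglongrightarrow> R"
    using LR by (rule nested_intervals_ends_tendsto)+
qed

text \<open>A single vector bounds the supremum from below once the set of minima is bounded above,
  here by 1; a nonempty \<open>I\<close> gives the minima a meaning.\<close>

lemma zadeh_extension_ge:
  assumes I: "finite I" "I \<noteq> {}" and x: "\<And>i a. i \<in> I \<Longrightarrow> a \<in> X \<Longrightarrow> x i a \<le> 1"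
    and a: "a \<in> I \<rightarrow>\<^sub>E X" "f a = y" "\<And>i. i \<in> I \<Longrightarrow> \<alpha> \<le> x i (a i)"
  shows "\<alpha> \<le> zadeh_extension I X f x y"
proof -
  define D where "D = {Min ((\<lambda>i. x i (a i)) ` I) | a. a \<in> I \<rightarrow>\<^sub>E X \<and> f a = y}"
  have D: "Min ((\<lambda>i. x i (a i)) ` I) \<in> D"
    using a unfolding D_def by blast
  have "d \<le> 1" if d: "d \<in> D" for d
  proof -
    obtain a where a: "d = Min ((\<lambda>i. x i (a i)) ` I)" "a \<in> I \<rightarrow>\<^sub>E X"
      using d unfolding D_def by blast
    obtain i where i: "i \<in> I"
      using I by blast
    then have "d \<le> x i (a i)"
      using I a by auto
    also have "\<dots> \<le> 1"
      using x[OF i] a i by auto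
    finally show ?thesis .
  qed
  then have "bdd_above D"
    by (rule bdd_aboveI)
  then have "Min ((\<lambda>i. x i (a i)) ` I) \<le> Sup D"
    by (rule cSup_upper[OF D])
  moreover have "\<alpha> \<le> Min ((\<lambda>i. x i (a i)) ` I)"
    using I a by auto
  moreover have "zadeh_extension I X f x y = Sup D"
    using D unfolding zadeh_extension_def D_def[symmetric] by auto
  ultimately show ?thesis
    by simp
qed

text \<open>The supremum need not be assumed to be attained: the witness is obtained only for levels
  strictly below it.\<close>

lemma zadeh_extension_witness:
  assumes I: "finite I" and \<beta>: "0 \<le> \<beta>" "\<beta> < zadeh_extension I X f x y"
  obtains a where "a \<in> I \<rightarrow>\<^sub>E X" "f a = y" "\<And>i. i \<in> I \<Longrightarrow> \<beta> \<le> x i (a i)"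
proof -
  define D where "D = {Min ((\<lambda>i. x i (a i)) ` I) | a. a \<in> I \<rightarrow>\<^sub>E X \<and> f a = y}"
  \<comment> \<open>An empty \<open>D\<close> would give the default value 0, contradicting
    \<open>0 \<le> \<beta>\<close> and the strict bound.\<close>
  have "D \<noteq> {}" "\<beta> < Sup D"
    using \<beta> unfolding zadeh_extension_def D_def[symmetric] by (auto split: if_splits)
  then obtain d where "d \<in> D" "\<beta> < d"
    using less_cSupD by blast
  then obtain a where a: "a \<in> I \<rightarrow>\<^sub>E X" "f a = y" "\<beta> < Min ((\<lambda>i. x i (a i)) ` I)"
    unfolding D_def by blast
  have "\<beta> \<le> x i (a i)" if "i \<in> I" for i
  proof -
    have "Min ((\<lambda>i. x i (a i)) ` I) \<le> x i (a i)"
      using I that by auto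
    with a(3) show ?thesis
      by linarith
  qed
  with a that show thesis
    by blast
qed

theorem theorem2:
  fixes T :: "'v fault_tree"
    and p :: "'v \<Rightarrow> real \<Rightarrow> real"
    and pl pr :: "real \<Rightarrow> 'v \<Rightarrow> real"
  assumes "is_fault_tree T"
    and "p \<in> basic_events T \<rightarrow> fuzzy_elements {0..1}"
    and "\<forall>v\<in>basic_events T. regular_fuzzy_number (extend_zero {0..1} (p v))"
    and "\<forall>\<alpha>\<in>{0<..1}. \<forall>v\<in>basic_events T. alpha_cut {0..1} (p v) \<alpha> = {pl \<alpha> v..pr \<alpha> v}"
  shows "\<forall>\<alpha>\<in>{0<..1}.
           alpha_cut {0..1} (fuzzy_unreliability T p) \<alpha> =
             {unreliability T (pl \<alpha>)..unreliability T (pr \<alpha>)}"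
proof -
  let ?E = "basic_events T"
  note T = assms(1) and fin = finite_basic_events[OF assms(1)]
    and ne = basic_events_nonempty[OF assms(1)]
  have cut: "alpha_cut {0..1} (p v) \<alpha> = {pl \<alpha> v..pr \<alpha> v}" if "0 < \<alpha>" "\<alpha> \<le> 1" "v \<in> ?E" for \<alpha> v
    using assms(4) that by auto
  have le: "pl \<alpha> v \<le> pr \<alpha> v" if \<alpha>: "0 < \<alpha>" "\<alpha> \<le> 1" "v \<in> ?E" for \<alpha> v
  proof -
    obtain l r where "l \<le> r" "alpha_cut UNIV (extend_zero {0..1} (p v)) \<alpha> = {l..r}"
      using assms(3) \<alpha> unfolding regular_fuzzy_number_def by (meson greaterThanAtMost_iff)
    \<comment> \<open>Extension by zero adds no point to a cut at a positive level, so regularity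
      makes the cuts on the unit interval nonempty.\<close>
    moreover have "alpha_cut UNIV (extend_zero {0..1} (p v)) \<alpha> = {pl \<alpha> v..pr \<alpha> v}"
      unfolding cut[OF \<alpha>, symmetric] using \<alpha> by (auto simp: alpha_cut_def extend_zero_def)
    ultimately show ?thesis
      by (metis atLeastatMost_empty_iff)
  qed
  have unit: "0 \<le> a \<and> a \<le> 1" and cutD: "\<alpha> \<le> p v a"
    if "0 < \<alpha>" "\<alpha> \<le> 1" "v \<in> ?E" "a \<in> {pl \<alpha> v..pr \<alpha> v}" for \<alpha> v a
    using that(4) unfolding cut[OF that(1-3), symmetric] by (auto simp: alpha_cut_def)
  have p1: "p v a \<le> 1" if "v \<in> ?E" "a \<in> {0..1}" for v a
    using assms(2) that unfolding fuzzy_elements_def by fastforce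
  \<comment> \<open>A witness for \<open>y\<close> lies coordinatewise in the cuts at level
    \<open>\<beta>\<close>, and monotonicity compares it with the vectors of ends.\<close>
  have enclosed: "y \<in> {unreliability T (pl \<beta>)..unreliability T (pr \<beta>)}"
    if \<beta>: "0 < \<beta>" "\<beta> \<le> 1" and y: "\<beta> < fuzzy_unreliability T p y" for \<beta> y
  proof -
    obtain a where a: "a \<in> ?E \<rightarrow>\<^sub>E {0..1}" "unreliability T a = y" "\<And>v. v \<in> ?E \<Longrightarrow> \<beta> \<le> p v (a v)"
      using zadeh_extension_witness[OF fin] \<beta> y unfolding fuzzy_unreliability_def
      by (metis less_imp_le)
    have "a v \<in> {pl \<beta> v..pr \<beta> v}" if "v \<in> ?E" for v
      unfolding cut[OF \<beta> that, symmetric] using a that by (auto simp: alpha_cut_def PiE_iff)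
    moreover have "pl \<beta> v \<in> {pl \<beta> v..pr \<beta> v}" "pr \<beta> v \<in> {pl \<beta> v..pr \<beta> v}" if "v \<in> ?E" for v
      using le[OF \<beta> that] by auto
    ultimately have "unreliability T (pl \<beta>) \<le> unreliability T a"
      "unreliability T a \<le> unreliability T (pr \<beta>)"
      using unit[OF \<beta>] by (auto intro!: unreliability_mono[OF T])
    with a show ?thesis
      by simp
  qed
  show ?thesis
  proof (intro ballI set_eqI iffI)
    fix \<alpha> y
    assume "\<alpha> \<in> {0<..1::real}" and "y \<in> alpha_cut {0..1} (fuzzy_unreliability T p) \<alpha>"
    then have \<alpha>: "0 < \<alpha>" "\<alpha> \<le> 1" and y: "\<alpha> \<le> fuzzy_unreliability T p y"
      by (auto simp: alpha_cut_def)
    \<comment> \<open>The offset 2 keeps \<open>\<beta> 0 = \<alpha> / 2\<close> positive; with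
      offset 1 it would be 0, a level at which no interval form of the cuts is assumed.\<close>
    define \<beta> where "\<beta> n = \<alpha> - \<alpha> / real (n + 2)" for n
    have \<beta>: "0 < \<beta> n" "\<beta> n < \<alpha>" for n
      using \<alpha> by (auto simp: \<beta>_def field_simps intro!: add_pos_nonneg)
    then have \<beta>1: "\<beta> n \<le> 1" for n
      using \<alpha> by (meson less_imp_le order_trans)
    have inc: "incseq \<beta>"
      unfolding incseq_def \<beta>_def using \<alpha> by (auto intro!: divide_left_mono)
    have lim: "\<beta> \<longlonglongrightarrow> \<alpha>"
      unfolding \<beta>_def by real_asymp
    note tendsto = alpha_cut_ends_tendsto[OF inc lim cut[OF \<beta>(1) \<beta>1] cut[OF \<alpha>] le[OF \<alpha>]]
    have enc: "unreliability T (pl (\<beta> n)) \<le> y" "y \<le> unreliability T (pr (\<beta> n))" for n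
      using enclosed[OF \<beta>(1) \<beta>1, of n y] \<beta>(2)[of n] y by auto
    \<comment> \<open>Convergence of the ends at each basic event suffices by continuity; the bounds
      \<open>enc\<close> then pass to the limit.\<close>
    have "(\<lambda>n. unreliability T (pl (\<beta> n))) \<longlonglongrightarrow> unreliability T (pl \<alpha>)"
      "(\<lambda>n. unreliability T (pr (\<beta> n))) \<longlonglongrightarrow> unreliability T (pr \<alpha>)"
      by (intro tendsto_unreliability[OF T] tendsto; assumption)+
    then show "y \<in> {unreliability T (pl \<alpha>)..unreliability T (pr \<alpha>)}"
      using enc by (auto intro: LIMSEQ_le_const LIMSEQ_le_const2)
  next
    fix \<alpha> y
    assume "\<alpha> \<in> {0<..1::real}" and y: "y \<in> {unreliability T (pl \<alpha>)..unreliability T (pr \<alpha>)}"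
    then have \<alpha>: "0 < \<alpha>" "\<alpha> \<le> 1"
      by auto
    obtain a where a: "\<And>v. v \<in> ?E \<Longrightarrow> a v \<in> {pl \<alpha> v..pr \<alpha> v}" "unreliability T a = y"
      using unreliability_intermediate_value[OF T, of "pl \<alpha>" "pr \<alpha>" y] le[OF \<alpha>] y
      by (metis atLeastAtMost_iff)
    have "\<alpha> \<le> zadeh_extension ?E {0..1} (unreliability T) p y"
    proof (rule zadeh_extension_ge[OF fin ne p1])
      show "restrict a ?E \<in> ?E \<rightarrow>\<^sub>E {0..1}"
        using unit[OF \<alpha> _ a(1)] by auto
    qed (use a cutD[OF \<alpha>] in \<open>auto simp: unreliability_restrict\<close>)
    \<comment> \<open>The value \<open>y\<close> is a probability, so it lies in the carrier of the
      cut.\<close>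
    moreover have "y \<in> {0..1}"
      using a(2) by (auto simp: unreliability_def)
    ultimately show "y \<in> alpha_cut {0..1} (fuzzy_unreliability T p) \<alpha>"
      by (simp add: alpha_cut_def fuzzy_unreliability_def)
  qed
qed

end
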